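(* $\mathsf{KD45}_{B}$ is a sound and complete axiomatization of $\mathcal{L}_B$ with respect to the class of all topological subset spaces: for every $\varphi\in\mathcal{L}_B$, $\varphi$ is provable in $\mathsf{KD45}_{B}$ if and only if $\varphi$ is valid in all topological subset models.
   Context: Language. Fix a countable set PROP of primitive propositions. $\mathcal{L}_B$ is generated by $\varphi ::= p \mid \neg\varphi \mid \varphi\wedge\psi \mid B\varphi$, $p\in$ PROP, with $\vee,\to,\leftrightarrow$ defined as usual. The logic $\mathsf{KD45}_B$ (over $\mathcal{L}_B$) consists of classical propositional logic (with modus ponens), the schemes $B(\varphi\to\psi)\to(B\varphi\to B\psi)$, $B\varphi\to\neg B\neg\varphi$, $B\varphi\to BB\varphi$, $\neg B\varphi\to B\neg B\varphi$, and the rule "from $\vdash\varphi$ infer $\vdash B\varphi$". Semantics. A topological subset model is a triple $\mathcal{X}=(X,\mathcal{T},v)$ where $X$ is a nonempty set, $\mathcal{T}$ is a topology on $X$, and $v:\mathrm{PROP}\to 2^X$. An epistemic scenario of $\mathcal X$ is a pair $(x,U)$ with $x\in U\in\mathcal{T}$. Let $\mathit{int}$ and $\mathit{cl}$ denote interior and closure in $(X,\mathcal{T})$, and let $[\![\varphi]\!]^{U}=\{y\in U : (\mathcal{X},y,U)\models\varphi\}$. Truth at an epistemic scenario is defined by: $(\mathcal{X},x,U)\models p$ iff $x\in v(p)$; $(\mathcal{X},x,U)\models\neg\varphi$ iff $(\mathcal{X},x,U)\not\models\varphi$; $(\mathcal{X},x,U)\models\varphi\wedge\psi$ iff $(\mathcal{X},x,U)\models\varphi$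 and $(\mathcal{X},x,U)\models\psi$; $(\mathcal{X},x,U)\models B\varphi$ iff $U\subseteq\mathit{cl}(\mathit{int}([\![\varphi]\!]^{U}))$. A formula is valid in $\mathcal{X}$ if it is true at every epistemic scenario of $\mathcal X$. *)

theory Defs
  imports "HOL-Analysis.Abstract_Topology"
begin

datatype 'p fm =
    Prop 'p
  | Neg "'p fm"
  | Con "'p fm" "'p fm"
  | Bel "'p fm"

abbreviation Imp :: "'p fm \<Rightarrow> 'p fm \<Rightarrow> 'p fm" where
  "Imp \<phi> \<psi> \<equiv> Neg (Con \<phi> (Neg \<psi>))"

(* Boolean evaluation in which formulas of the form Bel \<phi> are treated as atoms, so that
   tautology captures substitution instances of classical propositional tautologies. *)
primrec bool_eval :: "('p \<Rightarrow> bool) \<Rightarrow> ('p fm \<Rightarrow> bool) \<Rightarrow> 'p fm \<Rightarrow> bool" where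
  "bool_eval g h (Prop p) = g p"
| "bool_eval g h (Neg \<phi>) = (\<not> bool_eval g h \<phi>)"
| "bool_eval g h (Con \<phi> \<psi>) = (bool_eval g h \<phi> \<and> bool_eval g h \<psi>)"
| "bool_eval g h (Bel \<phi>) = h \<phi>"

definition tautology :: "'p fm \<Rightarrow> bool" where
  "tautology \<phi> \<longleftrightarrow> (\<forall>g h. bool_eval g h \<phi>)"

inductive KD45 :: "'p fm \<Rightarrow> bool" where
  Taut: "tautology \<phi> \<Longrightarrow> KD45 \<phi>"
| K: "KD45 (Imp (Bel (Imp \<phi> \<psi>)) (Imp (Bel \<phi>) (Bel \<psi>)))"
| D: "KD45 (Imp (Bel \<phi>) (Neg (Bel (Neg \<phi>))))"
| Four: "KD45 (Imp (Bel \<phi>) (Bel (Bel \<phi>)))"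
| Five: "KD45 (Imp (Neg (Bel \<phi>)) (Bel (Neg (Bel \<phi>))))"
| MP: "KD45 (Imp \<phi> \<psi>) \<Longrightarrow> KD45 \<phi> \<Longrightarrow> KD45 \<psi>"
| Nec: "KD45 \<phi> \<Longrightarrow> KD45 (Bel \<phi>)"

(* The underlying set of the model is topspace T. *)
definition topo_subset_model :: "'a topology \<Rightarrow> ('p \<Rightarrow> 'a set) \<Rightarrow> bool" where
  "topo_subset_model T v \<longleftrightarrow> topspace T \<noteq> {} \<and> (\<forall>p. v p \<subseteq> topspace T)"

definition epistemic_scenario :: "'a topology \<Rightarrow> 'a \<Rightarrow> 'a set \<Rightarrow> bool" where
  "epistemic_scenario T x U \<longleftrightarrow> x \<in> U \<and> openin T U"

primrec sat :: "'a topology \<Rightarrow> ('p \<Rightarrow> 'a set) \<Rightarrow> 'a \<Rightarrow> 'a set \<Rightarrow> 'p fm \<Rightarrow> bool" where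
  "sat T v x U (Prop p) \<longleftrightarrow> x \<in> v p"
| "sat T v x U (Neg \<phi>) \<longleftrightarrow> \<not> sat T v x U \<phi>"
| "sat T v x U (Con \<phi> \<psi>) \<longleftrightarrow> sat T v x U \<phi> \<and> sat T v x U \<psi>"
| "sat T v x U (Bel \<phi>) \<longleftrightarrow> U \<subseteq> T closure_of (T interior_of {y \<in> U. sat T v y U \<phi>})"

definition valid_in :: "'a topology \<Rightarrow> ('p \<Rightarrow> 'a set) \<Rightarrow> 'p fm \<Rightarrow> bool" where
  "valid_in T v \<phi> \<longleftrightarrow> (\<forall>x U. epistemic_scenario T x U \<longrightarrow> sat T v x U \<phi>)"

end

(* Soundness rests on the fact that relatively dense open sets are closed under finite
   intersection, and that the truth value of a belief is the same at all points of U.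
   For completeness, take a maximal theory \<Gamma> omitting the unprovable formula, and countably many
   maximal theories containing all beliefs of \<Gamma>, enough to refute every formula that is not believed
   in \<Gamma>.  The model has one point w labelled by \<Gamma>, all other points are isolated and labelled by the
   chosen theories, and the only neighbourhood of w is the whole space.  The interior of a set is then
   dense exactly if the set contains every point other than w, so belief becomes truth at all of these
   points. *)
theory Submission
  imports Defs "HOL-Library.Countable"
begin

text \<open>Witnesses in the countermodel are indexed by formulas; countability lets them be coded
  by points of any infinite type.\<close>

instance fm :: (countable) countable
  by countable_datatype

section \<open>Semantics of belief and soundness\<close>

lemma dense_open_Int:
  assumes "openin T U" "openin T A" "U \<subseteq> T closure_of A" "U \<subseteq> T closure_of B"
  shows "U \<subseteq> T closure_of (A \<inter> B)"
proof
  fix x assume x: "x \<in> U"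
  have "\<exists>y. y \<in> A \<inter> B \<and> y \<in> N" if N: "x \<in> N" "openin T N" for N
  proof -
    \<comment> \<open>N is cut down to U and then to A; openness of A makes the result a
      neighbourhood of y, a point of U, so it must meet B.\<close>
    have NU: "openin T (N \<inter> U)" by (rule openin_Int[OF N(2) assms(1)])
    have "x \<in> T closure_of A" using x assms(3) by (rule rev_subsetD)
    then obtain y where y: "y \<in> A" "y \<in> N \<inter> U"
      using x N(1) NU by (auto simp: in_closure_of)
    have NUA: "openin T (N \<inter> U \<inter> A)" by (rule openin_Int[OF NU assms(2)])
    have "y \<in> T closure_of B" using y(2) assms(4) by blast
    then obtain z where "z \<in> B" "z \<in> N \<inter> U \<inter> A"
      using y NUA unfolding in_closure_of by (metis IntI)
    then show ?thesis by blast
  qed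
  then show "x \<in> T closure_of (A \<inter> B)"
    using x openin_subset[OF assms(1)] by (auto simp: in_closure_of)
qed

text \<open>Interpreting the atoms of \<open>bool_eval\<close> by truth at a scenario specializes a
  tautology to that scenario.\<close>

lemma bool_eval_sat:
  "bool_eval (\<lambda>p. x \<in> v p) (\<lambda>\<psi>. sat T v x U (Bel \<psi>)) \<phi> \<longleftrightarrow> sat T v x U \<phi>"
  by (induction \<phi>) auto

lemma subset_closure_of_interior_of_self:
  "openin T U \<Longrightarrow> U \<subseteq> T closure_of (T interior_of U)"
  by (simp add: closure_of_subset interior_of_openin openin_subset)

lemma sat_Bel_const:
  assumes "openin T U" "\<And>y. y \<in> U \<Longrightarrow> sat T v y U \<phi>"
  shows "sat T v x U (Bel \<phi>)"
proof -
  have "{y \<in> U. sat T v y U \<phi>} = U" using assms(2) by blast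
  then show ?thesis using subset_closure_of_interior_of_self[OF assms(1)] by simp
qed

text \<open>Interior commutes with binary intersection, which reduces the claim to relatively dense
  open sets. The axioms K and D both rest on this.\<close>

lemma sat_Bel_Con:
  assumes "openin T U" "sat T v x U (Bel \<phi>)" "sat T v x U (Bel \<psi>)"
  shows "sat T v x U (Bel (Con \<phi> \<psi>))"
proof -
  have "U \<subseteq> T closure_of
      (T interior_of {y \<in> U. sat T v y U \<phi>} \<inter> T interior_of {y \<in> U. sat T v y U \<psi>})"
    using assms by (intro dense_open_Int) auto
  moreover have "{y \<in> U. sat T v y U (Con \<phi> \<psi>)} =
      {y \<in> U. sat T v y U \<phi>} \<inter> {y \<in> U. sat T v y U \<psi>}"
    by auto
  ultimately show ?thesis
    by (simp only: sat.simps(4) interior_of_Int)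
qed

lemma sat_Bel_mono:
  assumes "sat T v x U (Bel \<phi>)" "\<And>y. y \<in> U \<Longrightarrow> sat T v y U \<phi> \<Longrightarrow> sat T v y U \<psi>"
  shows "sat T v x U (Bel \<psi>)"
proof -
  have "T closure_of (T interior_of {y \<in> U. sat T v y U \<phi>})
      \<subseteq> T closure_of (T interior_of {y \<in> U. sat T v y U \<psi>})"
    using assms(2) by (intro closure_of_mono interior_of_mono) blast
  then show ?thesis using assms(1) by auto
qed

lemma sat_Bel_consistent:
  assumes "x \<in> U" "sat T v x U (Bel \<phi>)"
  shows "\<exists>y\<in>U. sat T v y U \<phi>"
proof (rule ccontr)
  assume "\<not> ?thesis"
  then have "{y \<in> U. sat T v y U \<phi>} = {}" by blast
  then show False using assms by (simp only: sat.simps(4)) simp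
qed

text \<open>The point varies in the induction while U stays fixed: necessitation needs its premise
  at every point of U.\<close>

lemma KD45_sound:
  "KD45 \<phi> \<Longrightarrow> openin T U \<Longrightarrow> x \<in> U \<Longrightarrow> sat T v x U \<phi>"
proof (induction arbitrary: x rule: KD45.induct)
  case (Taut \<phi>)
  then show ?case unfolding tautology_def using bool_eval_sat[of x v T U \<phi>] by blast
next
  case (K \<phi> \<psi>)
  have "sat T v x U (Bel \<psi>)" if "sat T v x U (Bel (Imp \<phi> \<psi>))" "sat T v x U (Bel \<phi>)"
    by (rule sat_Bel_mono[OF sat_Bel_Con[OF K(1) that]]) simp
  then show ?case by (simp only: sat.simps(2,3)) blast
next
  case (D \<phi>)
  have False if "sat T v x U (Bel \<phi>)" "sat T v x U (Bel (Neg \<phi>))"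
    using sat_Bel_consistent[OF D(2) sat_Bel_Con[OF D(1) that]] by simp
  then show ?case by (simp only: sat.simps(2,3)) blast
next
  case (Four \<phi>)
  \<comment> \<open>The clause for \<open>Bel\<close> does not mention the point, so a belief true
    at x is true throughout U; case \<open>Five\<close> uses the same for failing beliefs.\<close>
  have "sat T v x U (Bel (Bel \<phi>))" if "sat T v x U (Bel \<phi>)"
    using that by (intro sat_Bel_const[OF Four(1), where \<phi> = "Bel \<phi>"]) simp
  then show ?case by (simp only: sat.simps(2,3)) blast
next
  case (Five \<phi>)
  have "sat T v x U (Bel (Neg (Bel \<phi>)))" if "\<not> sat T v x U (Bel \<phi>)"
    using that by (intro sat_Bel_const[OF Five(1), where \<phi> = "Neg (Bel \<phi>)"]) simp
  then show ?case by (simp only: sat.simps(2,3)) blast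
next
  case (MP \<phi> \<psi>)
  then have "sat T v x U (Imp \<phi> \<psi>)" "sat T v x U \<phi>" by blast+
  then show ?case by (simp only: sat.simps(2,3)) blast
next
  case (Nec \<phi>)
  then show ?case by (intro sat_Bel_const) auto
qed

section \<open>Theories and Lindenbaum's lemma\<close>

definition closed_theory :: "'p fm set \<Rightarrow> bool" where
  "closed_theory S \<longleftrightarrow>
    (\<forall>\<phi>. KD45 \<phi> \<longrightarrow> \<phi> \<in> S) \<and> (\<forall>\<phi> \<psi>. Imp \<phi> \<psi> \<in> S \<longrightarrow> \<phi> \<in> S \<longrightarrow> \<psi> \<in> S)"

lemma closed_theory_KD45: "closed_theory S \<Longrightarrow> KD45 \<phi> \<Longrightarrow> \<phi> \<in> S"
  by (simp add: closed_theory_def)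

lemma closed_theory_MP: "closed_theory S \<Longrightarrow> Imp \<phi> \<psi> \<in> S \<Longrightarrow> \<phi> \<in> S \<Longrightarrow> \<psi> \<in> S"
  unfolding closed_theory_def by blast

lemma closed_theory_taut: "closed_theory S \<Longrightarrow> tautology \<phi> \<Longrightarrow> \<phi> \<in> S"
  by (simp add: closed_theory_KD45 Taut)

lemma closed_theory_taut1:
  "closed_theory S \<Longrightarrow> \<phi> \<in> S \<Longrightarrow> tautology (Imp \<phi> \<psi>) \<Longrightarrow> \<psi> \<in> S"
  by (meson closed_theory_MP closed_theory_taut)

lemma closed_theory_taut2:
  "closed_theory S \<Longrightarrow> \<phi> \<in> S \<Longrightarrow> \<psi> \<in> S \<Longrightarrow> tautology (Imp \<phi> (Imp \<psi> \<chi>)) \<Longrightarrow> \<chi> \<in> S"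
  by (meson closed_theory_MP closed_theory_taut)

lemma closed_theory_provable: "closed_theory {\<phi>. KD45 \<phi>}"
  unfolding closed_theory_def using MP by blast

text \<open>Necessitation supplies the theorems and axiom K supplies modus ponens.\<close>

lemma closed_theory_Bel:
  assumes "closed_theory S"
  shows "closed_theory {\<phi>. Bel \<phi> \<in> S}"
  unfolding closed_theory_def mem_Collect_eq
proof (intro conjI allI impI)
  fix \<phi> :: "'a fm" assume "KD45 \<phi>"
  then show "Bel \<phi> \<in> S" by (intro closed_theory_KD45[OF assms] Nec)
next
  fix \<phi> \<psi> :: "'a fm" assume "Bel (Imp \<phi> \<psi>) \<in> S" "Bel \<phi> \<in> S"
  then show "Bel \<psi> \<in> S"
    using closed_theory_MP[OF assms] closed_theory_KD45[OF assms K] by blast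
qed

text \<open>This set is the least closed theory containing S and \<phi>; it replaces derivations
  from hypotheses and the deduction theorem.\<close>

lemma closed_theory_Imp:
  assumes "closed_theory S"
  shows "closed_theory {\<psi>. Imp \<phi> \<psi> \<in> S}"
  unfolding closed_theory_def mem_Collect_eq
proof (intro conjI allI impI)
  fix \<psi> :: "'a fm" assume "KD45 \<psi>"
  then show "Imp \<phi> \<psi> \<in> S"
    using assms closed_theory_KD45 closed_theory_taut1[of S \<psi> "Imp \<phi> \<psi>"]
    by (auto simp: tautology_def)
next
  fix \<psi> \<chi> :: "'a fm" assume "Imp \<phi> (Imp \<psi> \<chi>) \<in> S" "Imp \<phi> \<psi> \<in> S"
  then show "Imp \<phi> \<chi> \<in> S"
    by (rule closed_theory_taut2[OF assms]) (auto simp: tautology_def)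
qed

text \<open>The equivalence read left to right is consistency, read right to left negation
  completeness.\<close>

definition complete_theory :: "'p fm set \<Rightarrow> bool" where
  "complete_theory S \<longleftrightarrow> closed_theory S \<and> (\<forall>\<phi>. Neg \<phi> \<in> S \<longleftrightarrow> \<phi> \<notin> S)"

lemma complete_theory_Con:
  assumes "complete_theory S"
  shows "Con \<phi> \<psi> \<in> S \<longleftrightarrow> \<phi> \<in> S \<and> \<psi> \<in> S"
proof -
  have S: "closed_theory S" using assms complete_theory_def by blast
  show ?thesis
    using closed_theory_taut1[OF S, of "Con \<phi> \<psi>" \<phi>] closed_theory_taut1[OF S, of "Con \<phi> \<psi>" \<psi>]
      closed_theory_taut2[OF S, of \<phi> \<psi> "Con \<phi> \<psi>"]
    by (auto simp: tautology_def)
qed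

text \<open>Zorn's lemma is applied to the closed theories that extend S and omit \<psi>; omitting
  \<psi> also guarantees consistency.\<close>

lemma lindenbaum:
  assumes "closed_theory S" "\<psi> \<notin> S"
  obtains M where "complete_theory M" "S \<subseteq> M" "\<psi> \<notin> M"
proof -
  define \<A> where "\<A> = {M. closed_theory M \<and> S \<subseteq> M \<and> \<psi> \<notin> M}"
  have "\<exists>M\<in>\<A>. \<forall>X\<in>\<A>. M \<subseteq> X \<longrightarrow> X = M"
  proof (rule subset_Zorn_nonempty)
    show "\<A> \<noteq> {}" using assms by (auto simp: \<A>_def)
  next
    fix \<C> assume \<C>: "\<C> \<noteq> {}" "subset.chain \<A> \<C>"
    then have sub: "\<C> \<subseteq> \<A>" and chain: "\<And>X Y. X \<in> \<C> \<Longrightarrow> Y \<in> \<C> \<Longrightarrow> X \<subseteq> Y \<or> Y \<subseteq> X"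
      by (auto simp: subset_chain_def)
    have "closed_theory (\<Union>\<C>)"
      unfolding closed_theory_def
    proof (intro conjI allI impI)
      fix \<phi> :: "'a fm" assume "KD45 \<phi>"
      moreover obtain X where "X \<in> \<C>" using \<C>(1) by blast
      moreover have "closed_theory X" using \<open>X \<in> \<C>\<close> sub by (auto simp: \<A>_def)
      ultimately show "\<phi> \<in> \<Union>\<C>" using closed_theory_KD45 by blast
    next
      fix \<phi> \<chi> assume "Imp \<phi> \<chi> \<in> \<Union>\<C>" "\<phi> \<in> \<Union>\<C>"
      then obtain X where "X \<in> \<C>" "Imp \<phi> \<chi> \<in> X" "\<phi> \<in> X"
        using chain by (meson UnionE in_mono)
      then show "\<chi> \<in> \<Union>\<C>" using sub closed_theory_MP by (fastforce simp: \<A>_def)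
    qed
    then show "\<Union>\<C> \<in> \<A>" using \<C>(1) sub by (auto simp: \<A>_def)
  qed
  then obtain M where "M \<in> \<A>" and maximal: "\<forall>X\<in>\<A>. M \<subseteq> X \<longrightarrow> X = M" by blast
  from \<open>M \<in> \<A>\<close> have M: "closed_theory M" "S \<subseteq> M" "\<psi> \<notin> M" by (simp_all add: \<A>_def)
  have max: "X = M" if "closed_theory X" "M \<subseteq> X" "\<psi> \<notin> X" for X
    using maximal that M(2) by (auto simp: \<A>_def)
  \<comment> \<open>Otherwise the extension of M by \<phi> still omits \<psi>, so by maximality it
    equals M, although it contains \<phi>.\<close>
  have imp: "Imp \<phi> \<psi> \<in> M" if "\<phi> \<notin> M" for \<phi>
  proof (rule ccontr)
    assume "Imp \<phi> \<psi> \<notin> M"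
    moreover have "M \<subseteq> {\<chi>. Imp \<phi> \<chi> \<in> M}"
      using closed_theory_taut1[OF M(1)] by (fastforce simp: tautology_def)
    ultimately have "{\<chi>. Imp \<phi> \<chi> \<in> M} = M"
      using max closed_theory_Imp[OF M(1)] by blast
    moreover have "Imp \<phi> \<phi> \<in> M"
      by (rule closed_theory_taut[OF M(1)]) (simp add: tautology_def)
    ultimately show False using that by blast
  qed
  have "Neg \<phi> \<in> M \<longleftrightarrow> \<phi> \<notin> M" for \<phi>
  proof
    assume "Neg \<phi> \<in> M"
    then show "\<phi> \<notin> M"
      using closed_theory_taut2[OF M(1), of \<phi> "Neg \<phi>" \<psi>] M(3) by (auto simp: tautology_def)
  next
    assume "\<phi> \<notin> M"
    show "Neg \<phi> \<in> M"
    proof (rule ccontr)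
      assume "Neg \<phi> \<notin> M"
      \<comment> \<open>Both \<phi> and its negation now imply \<psi> within M, so M would contain
        \<psi>.\<close>
      then show False
        using closed_theory_taut2[OF M(1) imp[OF \<open>\<phi> \<notin> M\<close>] imp, of "Neg \<phi>" \<psi>] M(3)
        by (auto simp: tautology_def)
    qed
  qed
  then have "complete_theory M" using M(1) by (simp add: complete_theory_def)
  then show thesis using that M by blast
qed

text \<open>By axiom D some formula, \<psi> or its negation, is not believed, so the belief set can
  be extended even if \<psi> is believed. Existence for every \<psi> permits a total choice function
  later.\<close>

lemma complete_theory_Bel_witness:
  assumes "complete_theory \<Gamma>"
  shows "\<exists>\<Delta>. complete_theory \<Delta> \<and> {\<phi>. Bel \<phi> \<in> \<Gamma>} \<subseteq> \<Delta> \<and> (Bel \<psi> \<notin> \<Gamma> \<longrightarrow> \<psi> \<notin> \<Delta>)"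
proof -
  have \<Gamma>: "closed_theory \<Gamma>" using assms complete_theory_def by blast
  have "Bel \<psi> \<notin> \<Gamma> \<or> Bel (Neg \<psi>) \<notin> \<Gamma>"
    using closed_theory_MP[OF \<Gamma> closed_theory_KD45[OF \<Gamma> D[of \<psi>]]] assms
    by (auto simp: complete_theory_def)
  then show ?thesis
    using lindenbaum[OF closed_theory_Bel[OF \<Gamma>]] by (metis mem_Collect_eq)
qed

text \<open>Introspection: a belief in \<Gamma> is itself believed by axiom 4, a non-belief is
  believed to be one by axiom 5, and \<Delta> contains whatever \<Gamma> believes.\<close>

lemma complete_theory_Bel_eq:
  assumes "complete_theory \<Gamma>" "complete_theory \<Delta>" "{\<phi>. Bel \<phi> \<in> \<Gamma>} \<subseteq> \<Delta>"
  shows "Bel \<psi> \<in> \<Delta> \<longleftrightarrow> Bel \<psi> \<in> \<Gamma>"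
proof -
  have \<Gamma>: "closed_theory \<Gamma>" using assms(1) complete_theory_def by blast
  show ?thesis
    using closed_theory_MP[OF \<Gamma> closed_theory_KD45[OF \<Gamma> Four[of \<psi>]]]
      closed_theory_MP[OF \<Gamma> closed_theory_KD45[OF \<Gamma> Five[of \<psi>]]] assms
    by (auto simp: complete_theory_def)
qed

section \<open>The excluded point topology\<close>

definition pinned_topology :: "'a \<Rightarrow> 'a topology" where
  "pinned_topology w = topology (\<lambda>U. w \<notin> U \<or> U = UNIV)"

lemma openin_pinned_topology: "openin (pinned_topology w) U \<longleftrightarrow> w \<notin> U \<or> U = UNIV"
proof -
  have "istopology (\<lambda>U. w \<notin> U \<or> U = UNIV)"
    unfolding istopology_def by blast
  then show ?thesis by (simp add: pinned_topology_def topology_inverse')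
qed

lemma topspace_pinned_topology: "topspace (pinned_topology w) = UNIV"
  by (auto simp: topspace_def openin_pinned_topology)

lemma pinned_topology_dense_interior:
  assumes "c \<noteq> w"
  shows "UNIV \<subseteq> pinned_topology w closure_of (pinned_topology w interior_of A) \<longleftrightarrow> - {w} \<subseteq> A"
proof
  assume dense: "UNIV \<subseteq> pinned_topology w closure_of (pinned_topology w interior_of A)"
  show "- {w} \<subseteq> A"
  proof
    fix x assume "x \<in> - {w}"
    then have "openin (pinned_topology w) {x}" by (auto simp: openin_pinned_topology)
    moreover have "x \<in> pinned_topology w closure_of (pinned_topology w interior_of A)"
      using dense by blast
    ultimately have "x \<in> pinned_topology w interior_of A" by (auto simp: in_closure_of)
    then show "x \<in> A" using interior_of_subset by fastforce
  qed
next
  assume "- {w} \<subseteq> A"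
  then have "- {w} \<subseteq> pinned_topology w interior_of A"
    by (intro interior_of_maximal) (auto simp: openin_pinned_topology)
  moreover have "UNIV \<subseteq> pinned_topology w closure_of (- {w})"
  proof
    fix x
    \<comment> \<open>For x = w the set N is the whole space and c is the required point; otherwise
      x itself serves.\<close>
    have "\<exists>y. y \<in> - {w} \<and> y \<in> N" if "x \<in> N" "w \<notin> N \<or> N = UNIV" for N
      using that assms by (cases "x = w") auto
    then show "x \<in> pinned_topology w closure_of (- {w})"
      by (simp add: in_closure_of topspace_pinned_topology openin_pinned_topology)
  qed
  ultimately show "UNIV \<subseteq> pinned_topology w closure_of (pinned_topology w interior_of A)"
    using closure_of_mono by blast
qed

section \<open>Truth lemma and completeness\<close>

lemma truth_lemma:
  assumes complete: "\<And>x. complete_theory (M x)"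
    and "c \<noteq> w"
    and beliefs: "\<And>x. x \<noteq> w \<Longrightarrow> {\<phi>. Bel \<phi> \<in> M w} \<subseteq> M x"
    and witness: "\<And>\<psi>. Bel \<psi> \<notin> M w \<Longrightarrow> \<exists>x. x \<noteq> w \<and> \<psi> \<notin> M x"
  shows "sat (pinned_topology w) (\<lambda>p. {x. Prop p \<in> M x}) x UNIV \<phi> \<longleftrightarrow> \<phi> \<in> M x"
proof (induction \<phi> arbitrary: x)
  case (Prop p)
  then show ?case by simp
next
  case (Neg \<phi>)
  then show ?case using complete by (simp add: complete_theory_def)
next
  case (Con \<phi> \<psi>)
  then show ?case using complete by (simp add: complete_theory_Con)
next
  case (Bel \<phi>)
  have "Bel \<phi> \<in> M x \<longleftrightarrow> Bel \<phi> \<in> M w"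
    using complete beliefs complete_theory_Bel_eq by metis
  \<comment> \<open>Left to right is \<open>beliefs\<close>; conversely, \<open>witness\<close>
    refutes an unbelieved formula at a point other than w.\<close>
  also have "\<dots> \<longleftrightarrow> - {w} \<subseteq> {y \<in> UNIV. \<phi> \<in> M y}"
    using beliefs witness by fastforce
  finally show ?case
    using Bel pinned_topology_dense_interior[OF \<open>c \<noteq> w\<close>] by simp
qed

lemma KD45_countermodel:
  fixes \<phi> :: "'p::countable fm"
  assumes "infinite (UNIV :: 'a set)" "\<not> KD45 \<phi>"
  obtains T :: "'a topology" and v :: "'p \<Rightarrow> 'a set"
  where "topo_subset_model T v" "\<not> valid_in T v \<phi>"
proof -
  obtain \<Gamma> where \<Gamma>: "complete_theory \<Gamma>" "\<phi> \<notin> \<Gamma>"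
    using lindenbaum[OF closed_theory_provable, of \<phi>] assms(2) by blast
  obtain \<Delta> where \<Delta>: "\<And>\<psi>. complete_theory (\<Delta> \<psi>)" "\<And>\<psi>. {\<chi>. Bel \<chi> \<in> \<Gamma>} \<subseteq> \<Delta> \<psi>"
    "\<And>\<psi>. Bel \<psi> \<notin> \<Gamma> \<Longrightarrow> \<psi> \<notin> \<Delta> \<psi>"
    using complete_theory_Bel_witness[OF \<Gamma>(1)] by metis
  fix w :: 'a
  have "infinite (- {w})" using assms(1) by (simp add: Compl_eq_Diff_UNIV)
  then obtain g :: "nat \<Rightarrow> 'a" where g: "inj g" "range g \<subseteq> - {w}"
    using infinite_countable_subset by blast
  \<comment> \<open>The point \<open>g n\<close> carries the theory chosen for the formula with code
    n. Points outside the range of g receive some theory \<Delta> \<psi> as well, which is harmless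
    since each contains all beliefs of \<Gamma>.\<close>
  define M where "M x = (if x = w then \<Gamma> else \<Delta> (from_nat (inv g x)))" for x
  have gw: "g n \<noteq> w" for n using g(2) by auto
  have M_g: "M (g (to_nat \<psi>)) = \<Delta> \<psi>" for \<psi>
    using g(1) gw by (simp add: M_def)
  let ?T = "pinned_topology w" and ?v = "\<lambda>p. {x. Prop p \<in> M x}"
  have "sat ?T ?v w UNIV \<phi> \<longleftrightarrow> \<phi> \<in> M w"
  proof (rule truth_lemma)
    show "complete_theory (M x)" for x using \<Gamma>(1) \<Delta>(1) by (simp add: M_def)
    show "g 0 \<noteq> w" by (rule gw)
    show "{\<chi>. Bel \<chi> \<in> M w} \<subseteq> M x" if "x \<noteq> w" for x using that \<Delta>(2) by (simp add: M_def)
    show "\<exists>x. x \<noteq> w \<and> \<psi> \<notin> M x" if "Bel \<psi> \<notin> M w" for \<psi>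
    proof (intro exI conjI)
      show "g (to_nat \<psi>) \<noteq> w" by (rule gw)
      show "\<psi> \<notin> M (g (to_nat \<psi>))" using that \<Delta>(3) M_g by (simp add: M_def)
    qed
  qed
  then have "\<not> sat ?T ?v w UNIV \<phi>" using \<Gamma>(2) by (simp add: M_def)
  then have "\<not> valid_in ?T ?v \<phi>"
    unfolding valid_in_def epistemic_scenario_def openin_pinned_topology by blast
  moreover have "topo_subset_model ?T ?v"
    by (simp add: topo_subset_model_def topspace_pinned_topology)
  ultimately show thesis using that by blast
qed

text \<open>Validity is relative to one carrier type, whose infinitude makes room for the
  countermodel. As \<open>topspace T\<close> may be a proper subset of the type, smaller spaces are
  covered too.\<close>

theorem theorem7:
  fixes \<phi> :: "'p::countable fm"
  assumes "infinite (UNIV :: 'a set)"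
  shows "KD45 \<phi> \<longleftrightarrow>
    (\<forall>(T :: 'a topology) (v :: 'p \<Rightarrow> 'a set). topo_subset_model T v \<longrightarrow> valid_in T v \<phi>)"
proof
  assume "KD45 \<phi>"
  then show "\<forall>(T :: 'a topology) (v :: 'p \<Rightarrow> 'a set). topo_subset_model T v \<longrightarrow> valid_in T v \<phi>"
    unfolding valid_in_def epistemic_scenario_def by (intro allI impI) (elim conjE, rule KD45_sound)
next
  assume valid: "\<forall>(T :: 'a topology) (v :: 'p \<Rightarrow> 'a set). topo_subset_model T v \<longrightarrow> valid_in T v \<phi>"
  show "KD45 \<phi>"
  proof (rule ccontr)
    assume "\<not> KD45 \<phi>"
    then obtain T :: "'a topology" and v :: "'p \<Rightarrow> 'a set"
      where "topo_subset_model T v" "\<not> valid_in T v \<phi>"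
      by (rule KD45_countermodel[OF assms])
    with valid show False by blast
  qed
qed

end
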